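(* Let $k \geq 2$. Suppose a $k$-graph $F$ is a core and its $2$-shadow contains an induced cycle of length at least $4$. Then the $F$-removal lemma is not polynomial.
   Context: A $k$-graph is a finite $k$-uniform hypergraph $F=(V(F),E(F))$; $v(F)=|V(F)|$. A homomorphism from a $k$-graph $F_1$ to a $k$-graph $F_2$ is a map $\varphi:V(F_1)\to V(F_2)$ such that $\{\varphi(x):x\in e\}\in E(F_2)$ for every $e\in E(F_1)$. The core of $F$ is the smallest (with respect to the number of vertices) subgraph of $F$ to which there is a homomorphism from $F$. $F$ is a core if it is the core of itself, i.e. there is no homomorphism from $F$ to a subgraph $F_0$ of $F$ with $V(F_0)\subsetneq V(F)$. The $2$-shadow of $F$ is the graph on vertex set $V(F)$ in which $\{u,v\}$ ($u \neq v$) is an edge if and only if $u,v$ both belong to some $e\in E(F)$. A copy of $F$ in a $k$-graph $G$ is a (not necessarily induced) subgraph of $G$ isomorphic to $F$. Copies are edge-disjoint if no two of them share an edge. The $F$-removal lemma is polynomial if there are constants $c,C>0$ depending only on $F$ such that for every $\varepsilon\in(0,1)$ and every $n \geq 1$, every $n$-vertex $k$-graph with at least $\varepsilon n^k$ pairwise edge-disjoint copies of $F$ contains at least $c\,\varepsilon^{C} n^{v(F)}$ copies of $F$. *)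

theory Defs
  imports Complex_Main
begin

record 'a hypergraph =
  verts :: "'a set"
  edges :: "'a set set"

definition k_graph :: "nat \<Rightarrow> 'a hypergraph \<Rightarrow> bool" where
  "k_graph k F \<longleftrightarrow> finite (verts F) \<and> (\<forall>e\<in>edges F. e \<subseteq> verts F \<and> card e = k)"

text \<open>The last conjunct makes a subgraph of a k-graph a k-graph again.\<close>

definition subgraph :: "'a hypergraph \<Rightarrow> 'a hypergraph \<Rightarrow> bool" where
  "subgraph H G \<longleftrightarrow> verts H \<subseteq> verts G \<and> edges H \<subseteq> edges G \<and> (\<forall>e\<in>edges H. e \<subseteq> verts H)"

definition homomorphism :: "('a \<Rightarrow> 'b) \<Rightarrow> 'a hypergraph \<Rightarrow> 'b hypergraph \<Rightarrow> bool" where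
  "homomorphism \<phi> F G \<longleftrightarrow> \<phi> ` verts F \<subseteq> verts G \<and> (\<forall>e\<in>edges F. \<phi> ` e \<in> edges G)"

definition is_core :: "'a hypergraph \<Rightarrow> bool" where
  "is_core F \<longleftrightarrow> \<not> (\<exists>F0 \<phi>. subgraph F0 F \<and> verts F0 \<subset> verts F \<and> homomorphism \<phi> F F0)"

definition isomorphic :: "'a hypergraph \<Rightarrow> 'b hypergraph \<Rightarrow> bool" where
  "isomorphic F G \<longleftrightarrow>
     (\<exists>\<phi>. bij_betw \<phi> (verts F) (verts G) \<and>
          (\<forall>e. e \<subseteq> verts F \<longrightarrow> (e \<in> edges F \<longleftrightarrow> \<phi> ` e \<in> edges G)))"

definition shadow2 :: "'a hypergraph \<Rightarrow> 'a hypergraph" where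
  "shadow2 F = \<lparr>verts = verts F,
     edges = {{u, v} | u v. u \<noteq> v \<and> (\<exists>e\<in>edges F. u \<in> e \<and> v \<in> e)}\<rparr>"

definition induced_subgraph :: "'a hypergraph \<Rightarrow> 'a set \<Rightarrow> 'a hypergraph" where
  "induced_subgraph G W = \<lparr>verts = W, edges = {e \<in> edges G. e \<subseteq> W}\<rparr>"

definition cycle_graph :: "nat \<Rightarrow> nat hypergraph" where
  "cycle_graph l = \<lparr>verts = {..<l}, edges = {{i, Suc i mod l} | i. i < l}\<rparr>"

definition has_induced_cycle :: "'a hypergraph \<Rightarrow> nat \<Rightarrow> bool" where
  "has_induced_cycle G l \<longleftrightarrow>
     (\<exists>W \<subseteq> verts G. isomorphic (cycle_graph l) (induced_subgraph G W))"

definition copies :: "'a hypergraph \<Rightarrow> 'b hypergraph \<Rightarrow> 'b hypergraph set" where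
  "copies F G = {H. subgraph H G \<and> isomorphic F H}"

definition edge_disjoint :: "'a hypergraph set \<Rightarrow> bool" where
  "edge_disjoint P \<longleftrightarrow> pairwise (\<lambda>H H'. edges H \<inter> edges H' = {}) P"

text \<open>The host graphs range over k-graphs with vertices in \<^typ>\<open>nat\<close>; every finite k-graph is
  isomorphic to one of these, so this is no restriction.\<close>

definition polynomial_removal_lemma :: "nat \<Rightarrow> 'a hypergraph \<Rightarrow> bool" where
  "polynomial_removal_lemma k F \<longleftrightarrow>
     (\<exists>c>0. \<exists>C>0. \<forall>\<epsilon>::real. \<forall>n::nat. \<forall>G :: nat hypergraph.
        0 < \<epsilon> \<and> \<epsilon> < 1 \<and> 1 \<le> n \<and> k_graph k G \<and> card (verts G) = n \<and>
        (\<exists>P \<subseteq> copies F G. edge_disjoint P \<and> \<epsilon> * real n ^ k \<le> real (card P))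
        \<longrightarrow> c * \<epsilon> powr C * real n ^ card (verts F) \<le> real (card (copies F G)))"

end

theory Submission
  imports Defs "HOL-Library.FuncSet" "HOL-Computational_Algebra.Polynomial"
begin

text \<open>Take an \<open>F\<close>-partite host and plant copies of \<open>F\<close> indexed by vectors \<open>a\<close> of \<open>k\<close> integers: the
  cycle vertices \<open>x\<^sub>0, \<dots>, x\<^sub>q\<close> get the values \<open>a 0 + i * a 1\<close>, the other vertices values of linear
  forms in general position. Since the cycle is induced of length at least \<open>4\<close>, an edge meets it
  in at most two vertices, so an edge determines \<open>a\<close> and the planted copies are edge-disjoint.
  Restrict \<open>a 1\<close> to a dense set in which \<open>s\<^sub>1 + \<dots> + s\<^sub>q = q * t\<close> has only trivial solutions.
  As \<open>F\<close> is a core, every copy in the host is partite, hence consecutive values on its cycle differ by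
  elements of that set, and going around the cycle they form an arithmetic progression. So one cycle
  vertex is determined by the others, which saves a full factor of the part size.\<close>

section \<open>Digit expansions and sets without nontrivial means\<close>

text \<open>Reduction modulo \<open>b\<close> isolates the lowest digit, and dividing the rest by
  \<open>b\<close> shifts the remaining digits down by one place.\<close>

lemma base_expansion_unique:
  fixes x y :: "nat \<Rightarrow> nat"
  assumes "\<And>j. j < r \<Longrightarrow> x j < b" "\<And>j. j < r \<Longrightarrow> y j < b"
    and "(\<Sum>j<r. x j * b ^ j) = (\<Sum>j<r. y j * b ^ j)" "j < r"
  shows "x j = y j"
  using assms
proof (induction r arbitrary: x y j)
  case (Suc r)
  have shift: "(\<Sum>j<Suc r. z j * b ^ j) = z 0 + b * (\<Sum>j<r. z (Suc j) * b ^ j)" for z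
    unfolding sum.lessThan_Suc_shift by (simp add: sum_distrib_left mult_ac)
  have b: "x 0 < b" "y 0 < b" using Suc.prems by auto
  have eq: "x 0 + b * (\<Sum>j<r. x (Suc j) * b ^ j) = y 0 + b * (\<Sum>j<r. y (Suc j) * b ^ j)"
    using Suc.prems(3) unfolding shift .
  have 0: "x 0 = y 0" using arg_cong[OF eq, of "\<lambda>n. n mod b"] b by simp
  with eq b have "(\<Sum>j<r. x (Suc j) * b ^ j) = (\<Sum>j<r. y (Suc j) * b ^ j)" by simp
  then have "x (Suc i) = y (Suc i)" if "i < r" for i
    using Suc.IH[of "\<lambda>j. x (Suc j)" "\<lambda>j. y (Suc j)" i] Suc.prems(1,2) that by auto
  with 0 Suc.prems(4) show ?case by (cases j) auto
qed simp

lemma base_expansion_less: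
  fixes x :: "nat \<Rightarrow> nat"
  assumes "\<And>j. j < r \<Longrightarrow> x j < b"
  shows "(\<Sum>j<r. x j * b ^ j) < b ^ r"
  using assms
proof (induction r)
  case (Suc r)
  have "(\<Sum>j<r. x j * b ^ j) < b ^ r" using Suc by simp
  moreover have "Suc (x r) * b ^ r \<le> b * b ^ r"
    using Suc.prems[of r] by (intro mult_right_mono) auto
  ultimately show ?case by simp
qed simp

text \<open>Behrend's idea: points of a sphere, read as digit vectors. The base \<open>q * d\<close> prevents
  carries when \<open>q\<close> of them are added.\<close>

lemma exists_large_set_without_nontrivial_mean:
  fixes q d r :: nat
  assumes q: "1 \<le> q" and d: "1 \<le> d" and r: "1 \<le> r"
  obtains S where "S \<subseteq> {..<(q * d) ^ r}" "d ^ r \<le> r * d\<^sup>2 * card S"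
    "\<forall>s. \<forall>t\<in>S. (\<forall>i<q. s i \<in> S) \<and> (\<Sum>i<q. s i) = q * t \<longrightarrow> (\<forall>i<q. s i = t)"
proof -
  define b where "b = q * d"
  define A where "A = ({..<r} \<rightarrow>\<^sub>E {..<d} :: (nat \<Rightarrow> nat) set)"
  define N where "N x = (\<Sum>j<r. (x j)\<^sup>2)" for x :: "nat \<Rightarrow> nat"
  define val where "val x = (\<Sum>j<r. x j * b ^ j)" for x :: "nat \<Rightarrow> nat"
  have A: "finite A" "card A = d ^ r" by (auto simp: A_def card_PiE intro!: finite_PiE)
  have db: "d \<le> b" using q by (simp add: b_def)
  have dig: "x j < d" if "x \<in> A" "j < r" for x j using that by (auto simp: A_def)
  have N: "N x < r * d\<^sup>2" if "x \<in> A" for x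
  proof -
    have "N x < (\<Sum>j<r. d\<^sup>2)" unfolding N_def
      using dig[OF that] r
      by (intro sum_strict_mono) (auto intro!: power_strict_mono simp: lessThan_empty_iff)
    then show ?thesis by simp
  qed
  \<comment> \<open>Pigeonhole: \<open>N\<close> takes fewer than \<open>r * d\<^sup>2\<close>
    values on the \<open>d ^ r\<close> points of \<open>A\<close>, so some sphere
    \<open>N x = R\<close> contains at least the average number of points.\<close>
  have "\<exists>R. d ^ r \<le> r * d\<^sup>2 * card {x \<in> A. N x = R}"
  proof (rule ccontr)
    assume "\<not> ?thesis"
    then have lt: "r * d\<^sup>2 * card {x \<in> A. N x = R} < d ^ r" for R by (simp add: not_le)
    have "A = (\<Union>R<r * d\<^sup>2. {x \<in> A. N x = R})" using N by auto
    then have "card A \<le> (\<Sum>R<r * d\<^sup>2. card {x \<in> A. N x = R})"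
      using card_UN_le[of "{..<r * d\<^sup>2}" "\<lambda>R. {x \<in> A. N x = R}"] by simp
    then have "r * d\<^sup>2 * d ^ r \<le> (\<Sum>R<r * d\<^sup>2. r * d\<^sup>2 * card {x \<in> A. N x = R})"
      using A by (simp flip: sum_distrib_left)
    also have "\<dots> < (\<Sum>R<r * d\<^sup>2. d ^ r)"
      using r d lt by (intro sum_strict_mono) (auto simp: lessThan_empty_iff)
    finally show False by simp
  qed
  then obtain R where R: "d ^ r \<le> r * d\<^sup>2 * card {x \<in> A. N x = R}" by blast
  define S where "S = val ` {x \<in> A. N x = R}"
  have inj: "inj_on val A"
  proof (rule inj_onI)
    fix x y assume xy: "x \<in> A" "y \<in> A" "val x = val y"
    have "x j = y j" if "j < r" for j
      by (rule base_expansion_unique[of r x b y])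
         (use xy dig[of x] dig[of y] db that in \<open>auto simp: val_def intro: less_le_trans\<close>)
    then show "x = y" using xy by (auto simp: A_def intro: PiE_ext)
  qed
  show thesis
  proof
    show "S \<subseteq> {..<(q * d) ^ r}"
      using less_le_trans[OF dig db]
      by (auto simp: S_def val_def intro!: base_expansion_less simp flip: b_def)
    have "card S = card {x \<in> A. N x = R}"
      unfolding S_def by (rule card_image) (rule inj_on_subset[OF inj], auto)
    then show "d ^ r \<le> r * d\<^sup>2 * card S" using R by simp
  next
    have "s i = t" if s: "\<And>i. i < q \<Longrightarrow> s i \<in> S" and t: "t \<in> S"
      and eq: "(\<Sum>i<q. s i) = q * t" and "i < q" for s t i
    proof -
      have "\<exists>x. x \<in> A \<and> N x = R \<and> s i = val x" if "i < q" for i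
        using s[OF that] by (auto simp: S_def)
      then obtain x where x: "\<And>i. i < q \<Longrightarrow> x i \<in> A \<and> N (x i) = R \<and> s i = val (x i)" by metis
      obtain y where y: "y \<in> A" "N y = R" "t = val y" using t by (auto simp: S_def)
      \<comment> \<open>Both sides are legal base \<open>b\<close> expansions of the same number, so
        the equation holds digit by digit and \<open>y\<close> is the mean of the vectors
        \<open>x i\<close>.\<close>
      have mean: "(\<Sum>i<q. x i j) = q * y j" if "j < r" for j
      proof (rule base_expansion_unique[of r "\<lambda>j. \<Sum>i<q. x i j" b "\<lambda>j. q * y j"])
        fix j assume j: "j < r"
        have "(\<Sum>i<q. x i j) < (\<Sum>i<q. d)"
          using q x dig j by (intro sum_strict_mono) (auto simp: lessThan_empty_iff)
        then show "(\<Sum>i<q. x i j) < b" by (simp add: b_def)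
        show "q * y j < b" using q dig[OF y(1) j] by (simp add: b_def)
      next
        have "(\<Sum>j<r. (\<Sum>i<q. x i j) * b ^ j) = (\<Sum>i<q. val (x i))"
          unfolding val_def sum_distrib_right by (rule sum.swap)
        also have "\<dots> = (\<Sum>i<q. s i)" using x by simp
        finally show "(\<Sum>j<r. (\<Sum>i<q. x i j) * b ^ j) = (\<Sum>j<r. q * y j * b ^ j)"
          using eq y by (simp add: val_def sum_distrib_left mult_ac)
      qed (use that in simp)
      \<comment> \<open>\<open>D i\<close> is the squared distance from \<open>x i\<close> to
        \<open>y\<close>. All these points have squared norm \<open>R\<close> and \<open>y\<close>
        is the mean of the \<open>x i\<close>, so the distances add up to
        \<open>2 q R - 2 q R = 0\<close> and each of them vanishes.\<close>
      define D where "D i = (\<Sum>j<r. (int (x i j) - int (y j))\<^sup>2)" for i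
      have Ni: "(\<Sum>j<r. (int (z j))\<^sup>2) = int R" if "N z = R" for z
        using that by (auto simp: N_def)
      have D: "D i = 2 * int R - 2 * (\<Sum>j<r. int (y j) * int (x i j))" if "i < q" for i
        using Ni[of "x i"] Ni[of y] x[OF that] y
        by (simp add: D_def power2_diff sum.distrib sum_subtractf mult_ac sum_distrib_left)
      have "(\<Sum>i<q. \<Sum>j<r. int (y j) * int (x i j)) = (\<Sum>j<r. int (y j) * int (\<Sum>i<q. x i j))"
        by (subst sum.swap) (simp add: sum_distrib_left)
      also have "\<dots> = (\<Sum>j<r. int q * (int (y j))\<^sup>2)"
        using mean by (intro sum.cong) (auto simp: power2_eq_square simp flip: of_nat_mult)
      also have "\<dots> = int q * int R" using Ni[of y] y by (simp flip: sum_distrib_left)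
      finally have "(\<Sum>i<q. D i) = 0" using D by (simp add: sum_subtractf flip: sum_distrib_left)
      then have "D i = 0" using \<open>i < q\<close> by (subst (asm) sum_nonneg_eq_0_iff) (auto simp: D_def sum_nonneg)
      then have "\<forall>j<r. x i j = y j" unfolding D_def by (subst (asm) sum_nonneg_eq_0_iff) auto
      then show ?thesis using x[OF \<open>i < q\<close>] y by (simp add: val_def)
    qed
    then show "\<forall>s. \<forall>t\<in>S. (\<forall>i<q. s i \<in> S) \<and> (\<Sum>i<q. s i) = q * t \<longrightarrow> (\<forall>i<q. s i = t)"
      by blast
  qed
qed

section \<open>Polynomials with prescribed zeros\<close>

text \<open>Multiplication by the factor with root \<open>t < 0\<close> adds a positive multiple of
  a polynomial to its shift, which preserves both sign conditions.\<close>

lemma coeff_prod_negative_roots: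
  fixes T :: "real set"
  assumes "finite T" "\<And>t. t \<in> T \<Longrightarrow> t < 0"
  shows "coeff (\<Prod>t\<in>T. [:-t, 1:]) 0 > 0 \<and> (\<forall>n. coeff (\<Prod>t\<in>T. [:-t, 1:]) n \<ge> 0)"
  using assms
proof (induction T rule: finite_induct)
  case (insert t T)
  let ?D = "\<Prod>t\<in>T. [:-t, 1:]"
  have eq: "(\<Prod>t\<in>insert t T. [:-t, 1:]) = smult (-t) ?D + pCons 0 ?D"
    using insert by simp
  have "t < 0" using insert.prems by auto
  moreover have "coeff ?D 0 > 0" "coeff ?D n \<ge> 0" for n using insert by auto
  ultimately show ?case unfolding eq
    by (auto simp: coeff_pCons mult_neg_pos mult_nonpos_nonneg split: nat.splits
        intro: order.trans[of _ 0])
qed auto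

text \<open>A polynomial of degree \<open>< k\<close> is determined by \<open>k\<close> conditions, up to two of which
  prescribe the value of its affine part at a nonnegative point. The roots are taken negative so
  that all coefficients of the product of their linear factors have the same sign.\<close>

lemma poly_zero_from_roots_and_affine_part:
  fixes p :: "real poly" and T Z :: "real set"
  assumes deg: "degree p < k" and fin: "finite T" "finite Z" and card: "card T + card Z = k"
    and Z2: "card Z \<le> 2" and neg: "\<And>t. t \<in> T \<Longrightarrow> t < 0" and nonneg: "\<And>z. z \<in> Z \<Longrightarrow> 0 \<le> z"
    and roots: "\<And>t. t \<in> T \<Longrightarrow> poly p t = 0"
    and aff: "\<And>z. z \<in> Z \<Longrightarrow> coeff p 0 + z * coeff p 1 = 0"
  shows "p = 0"
proof (rule ccontr)
  assume p: "p \<noteq> 0"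
  have bound: "card T \<le> degree g" if "g \<noteq> 0" "\<And>t. t \<in> T \<Longrightarrow> poly g t = 0" for g :: "real poly"
    using card_mono[OF poly_roots_finite[OF that(1)], of T] that(2) card_poly_roots_bound[OF that(1)]
    by fastforce
  consider "card Z = 0" | "card Z = 1" | "card Z = 2" using Z2 by linarith
  then show False
  proof cases
    case 1
    then show False using bound[OF p roots] card deg by simp
  next
    case 2
    then obtain z where z: "Z = {z}" by (auto simp: card_1_singleton_iff)
    \<comment> \<open>Here \<open>T\<close> has \<open>k - 1\<close> points, so \<open>p\<close> is
      a scalar multiple of the monic polynomial \<open>D\<close> with root set \<open>T\<close>. The
      signs of the coefficients of \<open>D\<close> make its affine part positive at
      \<open>z\<close>, so the scalar is \<open>0\<close>.\<close>
    define D where "D = (\<Prod>t\<in>T. [:-t, 1:])"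
    have degD: "degree D = card T" unfolding D_def
      by (subst degree_prod_eq_sum_degree) auto
    have lead: "coeff D (card T) = 1"
      using lead_coeff_prod[of "\<lambda>t. [:-t, 1:]" T] unfolding degD[symmetric] D_def by simp
    have rD: "poly D t = 0" if "t \<in> T" for t
      unfolding D_def poly_prod using that fin by auto
    define c where "c = coeff p (card T)"
    define g where "g = p - smult c D"
    have "coeff g i = 0" if "card T \<le> i" for i
    proof (cases "i = card T")
      case True
      then show ?thesis using lead by (simp add: g_def c_def)
    next
      case False
      then show ?thesis using that degD deg card 2
        by (simp add: g_def coeff_eq_0)
    qed
    moreover have "poly g t = 0" if "t \<in> T" for t using that roots rD by (simp add: g_def)
    ultimately have "g = 0"
      using bound[of g] by (metis leading_coeff_0_iff)
    then have pD: "p = smult c D" by (simp add: g_def)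
    have "coeff D 0 > 0" "coeff D 1 \<ge> 0"
      unfolding D_def using coeff_prod_negative_roots[OF fin(1) neg] by auto
    then have "coeff D 0 + z * coeff D 1 > 0" using nonneg z by (simp add: add_pos_nonneg)
    moreover have "c * (coeff D 0 + z * coeff D 1) = 0"
      using aff[of z] z by (simp add: pD algebra_simps)
    ultimately show False using p pD by simp
  next
    case 3
    then obtain z z' where z: "Z = {z, z'}" "z \<noteq> z'" by (meson card_2_iff)
    have "coeff p 0 + z * coeff p 1 = 0" "coeff p 0 + z' * coeff p 1 = 0" using aff z by auto
    then have "z * coeff p 1 = z' * coeff p 1" by linarith
    with z have c1: "coeff p 1 = 0" by simp
    with aff z have c0: "coeff p 0 = 0" by auto
    \<comment> \<open>An affine function with two zeros vanishes, so \<open>p\<close> is divisible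
      by the square of the variable. The points of \<open>T\<close> are nonzero, so all
      \<open>k - 2\<close> of them remain roots of the quotient \<open>g\<close>, whose degree is
      below \<open>k - 2\<close>.\<close>
    obtain g where g: "p = pCons 0 (pCons 0 g)"
      using c0 c1 by (metis One_nat_def coeff_pCons_0 coeff_pCons_Suc pCons_cases)
    have "g \<noteq> 0" using p g by auto
    moreover have "poly g t = 0" if "t \<in> T" for t using roots[OF that] neg[OF that] g by simp
    ultimately have "card T \<le> degree g" by (rule bound)
    moreover have "degree p = degree g + 2" using \<open>g \<noteq> 0\<close> g by simp
    ultimately show False using deg card 3 by simp
  qed
qed

section \<open>Induced cycles in the shadow\<close>

text \<open>Inducedness turns a shadow edge between cycle vertices back into an edge of the cycle.
  Three cycle vertices in one edge of \<open>F\<close> would thus be pairwise adjacent on the cycle,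
  but a cycle of length at least 4 has no triangle.\<close>

lemma cycle_of_shadow:
  assumes "has_induced_cycle (shadow2 F) l" "4 \<le> l"
  obtains x where "inj_on x {..<l}" "x ` {..<l} \<subseteq> verts F"
    "\<And>i. i < l \<Longrightarrow> \<exists>e\<in>edges F. x i \<in> e \<and> x (Suc i mod l) \<in> e"
    "\<And>e. e \<in> edges F \<Longrightarrow> card (e \<inter> x ` {..<l}) \<le> 2"
proof -
  obtain W x where W: "W \<subseteq> verts F" and bij: "bij_betw x {..<l} W"
    and iso: "\<And>e. e \<subseteq> {..<l} \<Longrightarrow> e \<in> edges (cycle_graph l) \<longleftrightarrow>
      x ` e \<in> edges (shadow2 F) \<and> x ` e \<subseteq> W"
    using assms(1) unfolding has_induced_cycle_def isomorphic_def
    by (auto simp: induced_subgraph_def cycle_graph_def shadow2_def)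
  have inj: "inj_on x {..<l}" and img: "x ` {..<l} = W" using bij by (auto simp: bij_betw_def)
  have adj: "j = Suc i mod l \<or> i = Suc j mod l"
    if "e \<in> edges F" "x i \<in> e" "x j \<in> e" "i < l" "j < l" "i \<noteq> j" for e i j
  proof -
    have "x i \<noteq> x j" using that inj by (auto dest: inj_onD)
    then have "x ` {i, j} \<in> edges (shadow2 F)" using that by (auto simp: shadow2_def)
    moreover have "x ` {i, j} \<subseteq> W" using that img by auto
    ultimately have "{i, j} \<in> edges (cycle_graph l)" using iso[of "{i, j}"] that by simp
    then show ?thesis by (auto simp: cycle_graph_def doubleton_eq_iff)
  qed
  show thesis
  proof
    show "inj_on x {..<l}" by fact
    show "x ` {..<l} \<subseteq> verts F" using img W by simp
  next
    fix i assume "i < l"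
    then have "{i, Suc i mod l} \<in> edges (cycle_graph l)" "{i, Suc i mod l} \<subseteq> {..<l}"
      by (auto simp: cycle_graph_def)
    then have "x ` {i, Suc i mod l} \<in> edges (shadow2 F)" using iso by blast
    then obtain u v e where uv: "{x i, x (Suc i mod l)} = {u, v}" "e \<in> edges F" "u \<in> e" "v \<in> e"
      by (auto simp: shadow2_def)
    then have "x i \<in> e" "x (Suc i mod l) \<in> e" by (auto simp: doubleton_eq_iff)
    then show "\<exists>e\<in>edges F. x i \<in> e \<and> x (Suc i mod l) \<in> e" using uv by blast
  next
    fix e assume e: "e \<in> edges F"
    define I where "I = {i. i < l \<and> x i \<in> e}"
    have "e \<inter> x ` {..<l} = x ` I" by (auto simp: I_def)
    moreover have "inj_on x I" using inj by (rule inj_on_subset) (auto simp: I_def)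
    ultimately have c: "card (e \<inter> x ` {..<l}) = card I" by (simp add: card_image)
    have "card I \<le> 2"
    proof (rule ccontr)
      assume "\<not> ?thesis"
      then obtain J where "J \<subseteq> I" "card J = 3"
        by (metis obtain_subset_with_card_n not_less_eq_eq numeral_2_eq_2 numeral_3_eq_3)
      then obtain i j m where J: "J = {i, j, m}" "i \<noteq> j" "i \<noteq> m" "j \<noteq> m"
        by (auto simp: card_3_iff)
      have lt: "i < l" "j < l" "m < l" and "x i \<in> e" "x j \<in> e" "x m \<in> e"
        using J \<open>J \<subseteq> I\<close> by (auto simp: I_def)
      then have "j = Suc i mod l \<or> i = Suc j mod l" "m = Suc i mod l \<or> i = Suc m mod l"
        "m = Suc j mod l \<or> j = Suc m mod l" using adj e J by blast+
      then show False using lt J assms(2) by (auto simp: mod_Suc split: if_splits)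
    qed
    with c show "card (e \<inter> x ` {..<l}) \<le> 2" by simp
  qed
qed

section \<open>Endomorphisms of a core and partite hosts\<close>

text \<open>The image of \<open>\<sigma>\<close> is a subgraph to which \<open>F\<close> maps, so it
  cannot lose a vertex. By finiteness \<open>\<sigma>\<close> is then injective on vertices, hence
  on edges, and an injective self-map of a finite set is onto.\<close>

lemma core_endomorphism:
  assumes F: "k_graph k F" and core: "is_core F" and hom: "homomorphism \<sigma> F F"
  shows "bij_betw \<sigma> (verts F) (verts F)" "(`) \<sigma> ` edges F = edges F"
proof -
  have fin: "finite (verts F)" and sub: "\<And>e. e \<in> edges F \<Longrightarrow> e \<subseteq> verts F"
    using F by (auto simp: k_graph_def)
  have \<sigma>: "\<sigma> ` verts F \<subseteq> verts F" "\<And>e. e \<in> edges F \<Longrightarrow> \<sigma> ` e \<in> edges F"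
    using hom by (auto simp: homomorphism_def)
  define F0 where "F0 = \<lparr>verts = \<sigma> ` verts F, edges = (`) \<sigma> ` edges F\<rparr>"
  have "subgraph F0 F" "homomorphism \<sigma> F F0"
    using \<sigma> by (auto simp: F0_def subgraph_def homomorphism_def dest: subsetD[OF sub])
  then have "\<not> verts F0 \<subset> verts F" using core unfolding is_core_def by blast
  then have img: "\<sigma> ` verts F = verts F" using \<sigma> by (auto simp: F0_def)
  then have inj: "inj_on \<sigma> (verts F)" using fin by (simp add: eq_card_imp_inj_on)
  then show "bij_betw \<sigma> (verts F) (verts F)" using img by (simp add: bij_betw_def)
  have "edges F \<subseteq> Pow (verts F)" using sub by blast
  then have "finite (edges F)" "inj_on ((`) \<sigma>) (edges F)"
    using fin inj inj_on_image_Pow[OF inj] by (auto intro: finite_subset inj_on_subset)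
  then show "(`) \<sigma> ` edges F = edges F" using \<sigma> by (intro endo_inj_surj) auto
qed

text \<open>The host has one part per vertex of \<open>F\<close>, each a copy of \<open>D\<close>, and is a union of copies of
  \<open>F\<close> planted along \<open>f a\<close> for \<open>a \<in> W\<close>. Projecting to the parts turns any copy of \<open>F\<close> into an
  endomorphism of the core, so up to an automorphism every copy picks one vertex in each part.\<close>

lemma planted_host:
  fixes F :: "'a hypergraph" and f :: "'w \<Rightarrow> 'a \<Rightarrow> 'b"
  assumes F: "k_graph k F" and core: "is_core F" and E: "edges F \<noteq> {}"
    and D: "finite D" and fD: "\<And>a v. a \<in> W \<Longrightarrow> v \<in> verts F \<Longrightarrow> f a v \<in> D"
    and sep: "\<And>a a' e. \<lbrakk>a \<in> W; a' \<in> W; e \<in> edges F; \<And>v. v \<in> e \<Longrightarrow> f a v = f a' v\<rbrakk> \<Longrightarrow> a = a'"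
    and u: "u \<in> verts F"
    and rigid: "\<And>b b'. \<lbrakk>\<And>e. e \<in> edges F \<Longrightarrow> \<exists>a\<in>W. \<forall>v\<in>e. b v = f a v;
        \<And>e. e \<in> edges F \<Longrightarrow> \<exists>a\<in>W. \<forall>v\<in>e. b' v = f a v;
        \<And>v. v \<in> verts F - {u} \<Longrightarrow> b v = b' v\<rbrakk> \<Longrightarrow> b u = b' u"
  obtains G :: "nat hypergraph" and P where "k_graph k G"
    "card (verts G) = card (verts F) * card D"
    "P \<subseteq> copies F G" "edge_disjoint P" "card P = card W"
    "card (copies F G) \<le> card D ^ (card (verts F) - 1)"
proof -
  define V where "V = verts F"
  have finV: "finite V" and sub: "\<And>e. e \<in> edges F \<Longrightarrow> e \<subseteq> V"
    and cardE: "\<And>e. e \<in> edges F \<Longrightarrow> card e = k"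
    using F by (auto simp: k_graph_def V_def)
  \<comment> \<open>Hosts have natural numbers as vertices, so the pairs of a part and a value in it
    are numbered by \<open>g\<close>.\<close>
  obtain g :: "'a \<times> 'b \<Rightarrow> nat" where g: "inj_on g (V \<times> D)"
    using finV D ex_bij_betw_finite_nat[of "V \<times> D"] by (auto simp: bij_betw_def)
  define G where "G = \<lparr>verts = g ` (V \<times> D),
    edges = {(\<lambda>v. g (v, f a v)) ` e | a e. a \<in> W \<and> e \<in> edges F}\<rparr>"
  \<comment> \<open>For \<open>b\<close> with values in \<open>D\<close>, \<open>emb b\<close> is
    the copy of \<open>F\<close> that uses the vertex with value \<open>b v\<close> in part
    \<open>v\<close>.\<close>
  define emb where "emb b = \<lparr>verts = (\<lambda>v. g (v, b v)) ` V,
    edges = (\<lambda>e. (\<lambda>v. g (v, b v)) ` e) ` edges F\<rparr>" for b :: "'a \<Rightarrow> 'b"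
  have inj: "inj_on (\<lambda>v. g (v, b v)) V" if "\<And>v. v \<in> V \<Longrightarrow> b v \<in> D" for b
    by (rule inj_onI) (use that in \<open>auto dest: inj_onD[OF g]\<close>)
  \<comment> \<open>A host vertex remembers its part, so an embedded edge determines the edge of
    \<open>F\<close> it comes from and the values on it.\<close>
  have graph_eq: "e = e' \<and> (\<forall>v\<in>e. b v = b' v)"
    if eq: "(\<lambda>v. g (v, b v)) ` e = (\<lambda>v. g (v, b' v)) ` e'"
      and "e \<subseteq> V" "e' \<subseteq> V" "\<And>v. v \<in> V \<Longrightarrow> b v \<in> D" "\<And>v. v \<in> V \<Longrightarrow> b' v \<in> D" for b b' e e'
  proof -
    have "g ` (\<lambda>v. (v, b v)) ` e = g ` (\<lambda>v. (v, b' v)) ` e'" using eq by (simp add: image_image)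
    moreover have "(\<lambda>v. (v, b v)) ` e \<subseteq> V \<times> D" "(\<lambda>v. (v, b' v)) ` e' \<subseteq> V \<times> D"
      using that by auto
    ultimately have "(\<lambda>v. (v, b v)) ` e = (\<lambda>v. (v, b' v)) ` e'"
      using g by (simp add: inj_on_image_eq_iff)
    then show ?thesis by (auto simp: set_eq_iff image_iff)
  qed
  have fDV: "\<And>a v. a \<in> W \<Longrightarrow> v \<in> V \<Longrightarrow> f a v \<in> D" using fD by (simp add: V_def)
  have iso: "isomorphic F (emb b)" if "\<And>v. v \<in> V \<Longrightarrow> b v \<in> D" for b
    unfolding isomorphic_def
  proof (intro exI conjI allI impI)
    show "bij_betw (\<lambda>v. g (v, b v)) (verts F) (verts (emb b))"
      using inj[OF that] by (simp add: emb_def bij_betw_def V_def)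
    show "e \<in> edges F \<longleftrightarrow> (\<lambda>v. g (v, b v)) ` e \<in> edges (emb b)" if "e \<subseteq> verts F" for e
      using inj_on_image_eq_iff[OF inj[of b]] \<open>\<And>v. v \<in> V \<Longrightarrow> b v \<in> D\<close> that sub
      by (auto simp: emb_def V_def)
  qed
  define P where "P = (\<lambda>a. emb (f a)) ` W"
  have disj: "edges (emb (f a)) \<inter> edges (emb (f a')) = {}" if "a \<in> W" "a' \<in> W" "a \<noteq> a'" for a a'
  proof (rule ccontr)
    assume "\<not> ?thesis"
    then obtain e e' where e: "e \<in> edges F" "e' \<in> edges F"
      and eq: "(\<lambda>v. g (v, f a v)) ` e = (\<lambda>v. g (v, f a' v)) ` e'"
      by (auto simp: emb_def)
    have "\<forall>v\<in>e. f a v = f a' v"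
      using graph_eq[OF eq sub[OF e(1)] sub[OF e(2)] fDV[OF that(1)] fDV[OF that(2)]] by blast
    then show False using sep[OF that(1,2) e(1)] that(3) by blast
  qed
  have injW: "inj_on (\<lambda>a. emb (f a)) W"
  proof (rule inj_onI)
    fix a a' assume "a \<in> W" "a' \<in> W" "emb (f a) = emb (f a')"
    moreover have "edges (emb (f a)) \<noteq> {}" using E by (simp add: emb_def)
    ultimately show "a = a'" using disj[of a a'] by auto
  qed
  \<comment> \<open>\<open>B\<close> consists of the choices that look planted on every edge,
    possibly along different elements of \<open>W\<close> on different edges.\<close>
  define B where "B = {b \<in> V \<rightarrow>\<^sub>E D. \<forall>e\<in>edges F. \<exists>a\<in>W. \<forall>v\<in>e. b v = f a v}"
  have "copies F G \<subseteq> emb ` B"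
  proof
    fix H assume "H \<in> copies F G"
    then have HG: "subgraph H G" and "isomorphic F H" by (auto simp: copies_def)
    then obtain \<phi> where \<phi>: "bij_betw \<phi> V (verts H)"
      and \<phi>e: "\<And>e. e \<subseteq> V \<Longrightarrow> e \<in> edges F \<longleftrightarrow> \<phi> ` e \<in> edges H"
      by (auto simp: isomorphic_def V_def)
    have \<phi>G: "\<phi> v \<in> g ` (V \<times> D)" if "v \<in> V" for v
      using \<phi> HG that by (auto simp: bij_betw_def subgraph_def G_def)
    define h where "h = inv_into (V \<times> D) g"
    have h: "h (g z) = z" if "z \<in> V \<times> D" for z using g that by (simp add: h_def)
    define \<sigma> where "\<sigma> v = fst (h (\<phi> v))" for v
    define c where "c v = snd (h (\<phi> v))" for v
    have \<sigma>c: "\<sigma> v \<in> V" "c v \<in> D" "\<phi> v = g (\<sigma> v, c v)" if "v \<in> V" for v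
      using \<phi>G[OF that] by (auto simp: \<sigma>_def c_def h)
    \<comment> \<open>Projecting a host edge to the parts gives back the edge of \<open>F\<close>
      along which it was planted.\<close>
    have "\<sigma> ` e \<in> edges F" if e: "e \<in> edges F" for e
    proof -
      have "\<phi> ` e \<in> edges G" using \<phi>e[of e] sub e HG by (auto simp: subgraph_def)
      then obtain a e' where a: "a \<in> W" "e' \<in> edges F" "\<phi> ` e = (\<lambda>v. g (v, f a v)) ` e'"
        by (auto simp: G_def)
      have "\<sigma> ` e = (\<lambda>y. fst (h y)) ` \<phi> ` e" by (simp add: \<sigma>_def image_image)
      also have "\<dots> = (\<lambda>v. fst (h (g (v, f a v)))) ` e'" by (simp add: a image_image)
      also have "\<dots> = (\<lambda>v. v) ` e'"
        using a sub[of e'] fDV by (intro image_cong) (auto simp: h)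
      finally show ?thesis using a by simp
    qed
    then have "homomorphism \<sigma> F F" using \<sigma>c by (auto simp: homomorphism_def V_def)
    from core_endomorphism[OF F core this] have \<sigma>: "bij_betw \<sigma> V V" "(`) \<sigma> ` edges F = edges F"
      by (auto simp: V_def)
    \<comment> \<open>Reindexing by the automorphism \<open>\<sigma>\<close> gives
      \<open>\<phi> v = g (\<sigma> v, b (\<sigma> v))\<close>; since \<open>\<sigma>\<close>
      permutes the edges of \<open>F\<close>, the copy \<open>H\<close> is
      \<open>emb b\<close>.\<close>
    define b where "b = restrict (\<lambda>v. c (inv_into V \<sigma> v)) V"
    have b: "b (\<sigma> v) = c v" if "v \<in> V" for v
      using \<sigma>c(1)[OF that] that bij_betw_inv_into_left[OF \<sigma>(1) that] by (simp add: b_def)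
    have bD: "b \<in> V \<rightarrow>\<^sub>E D"
      using \<sigma>(1) \<sigma>c(2) by (auto simp: b_def bij_betw_def inv_into_into)
    have \<phi>b: "\<phi> ` A = (\<lambda>v. g (v, b v)) ` \<sigma> ` A" if "A \<subseteq> V" for A
      using that \<sigma>c(3) b by (auto simp: image_image intro!: image_cong)
    \<comment> \<open>The isomorphism condition speaks only of sets \<open>e \<subseteq> V\<close>;
      that the edges of \<open>H\<close> lie inside \<open>verts H\<close> comes from
      \<open>subgraph\<close>.\<close>
    have edgesH: "edges H = (`) \<phi> ` edges F"
    proof
      show "(`) \<phi> ` edges F \<subseteq> edges H" using \<phi>e sub by auto
      show "edges H \<subseteq> (`) \<phi> ` edges F"
      proof
        fix e assume e: "e \<in> edges H"
        then have "e \<subseteq> \<phi> ` V" using HG \<phi> by (auto simp: subgraph_def bij_betw_def)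
        then obtain e' where "e' \<subseteq> V" "e = \<phi> ` e'" by (auto simp: subset_image_iff)
        then show "e \<in> (`) \<phi> ` edges F" using \<phi>e e by auto
      qed
    qed
    have "edges H = (\<lambda>e. (\<lambda>v. g (v, b v)) ` \<sigma> ` e) ` edges F"
      unfolding edgesH by (intro image_cong refl \<phi>b sub)
    also have "\<dots> = (\<lambda>e. (\<lambda>v. g (v, b v)) ` e) ` (`) \<sigma> ` edges F"
      by (rule image_image[symmetric])
    finally have "edges H = (\<lambda>e. (\<lambda>v. g (v, b v)) ` e) ` (`) \<sigma> ` edges F" .
    moreover have "verts H = (\<lambda>v. g (v, b v)) ` V"
      using \<phi>b[of V] \<phi> \<sigma>(1) by (simp add: bij_betw_def)
    ultimately have H: "H = emb b" unfolding \<sigma>(2) by (simp add: emb_def)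
    have "\<exists>a\<in>W. \<forall>v\<in>e. b v = f a v" if e: "e \<in> edges F" for e
    proof -
      have "(\<lambda>v. g (v, b v)) ` e \<in> edges G" using e HG by (auto simp: H emb_def subgraph_def)
      then obtain a e' where a: "a \<in> W" "e' \<in> edges F"
        and eq: "(\<lambda>v. g (v, b v)) ` e = (\<lambda>v. g (v, f a v)) ` e'"
        by (auto simp: G_def)
      have "\<forall>v\<in>e. b v = f a v"
        using graph_eq[OF eq sub[OF e] sub[OF a(2)] _ fDV[OF a(1)]] bD by blast
      then show ?thesis using a by blast
    qed
    then show "H \<in> emb ` B" using H bD by (auto simp: B_def)
  qed
  moreover have "finite B" unfolding B_def using finV D by (simp add: finite_PiE)
  ultimately have "card (copies F G) \<le> card B" using surj_card_le[of B "copies F G" emb] by blast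
  \<comment> \<open>By \<open>rigid\<close> the value at \<open>u\<close> follows from the others,
    so restriction to \<open>V - {u}\<close> is injective on \<open>B\<close>. This saves one factor
    \<open>card D\<close>.\<close>
  also have "\<dots> \<le> card ((V - {u}) \<rightarrow>\<^sub>E D)"
  proof (rule card_inj_on_le)
    show "inj_on (\<lambda>b. restrict b (V - {u})) B"
    proof (rule inj_onI)
      fix b b' assume B: "b \<in> B" "b' \<in> B" and eq: "restrict b (V - {u}) = restrict b' (V - {u})"
      have agree: "b v = b' v" if "v \<in> V - {u}" for v using fun_cong[OF eq, of v] that by simp
      have "b u = b' u"
      proof (rule rigid)
        show "\<exists>a\<in>W. \<forall>v\<in>e. b v = f a v" "\<exists>a\<in>W. \<forall>v\<in>e. b' v = f a v" if "e \<in> edges F" for e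
          using B that unfolding B_def by blast+
      qed (use agree in \<open>simp add: V_def\<close>)
      with agree have "b v = b' v" if "v \<in> V" for v using that by (cases "v = u") auto
      then show "b = b'" using B by (auto simp: B_def intro: PiE_ext)
    qed
    show "(\<lambda>b. restrict b (V - {u})) ` B \<subseteq> (V - {u}) \<rightarrow>\<^sub>E D"
      by (auto simp: B_def split: if_splits)
    show "finite ((V - {u}) \<rightarrow>\<^sub>E D)" using finV D by (auto intro!: finite_PiE)
  qed
  also have "\<dots> = card D ^ (card V - 1)" using finV u by (simp add: card_PiE V_def)
  finally have few: "card (copies F G) \<le> card D ^ (card V - 1)" .
  show thesis
  proof
    show "k_graph k G"
      unfolding k_graph_def
    proof (intro conjI ballI)
      show "finite (verts G)" using finV D by (simp add: G_def)
      fix e' assume "e' \<in> edges G"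
      then obtain a e where ae: "a \<in> W" "e \<in> edges F" "e' = (\<lambda>v. g (v, f a v)) ` e"
        by (auto simp: G_def)
      then show "e' \<subseteq> verts G" using sub[of e] fDV by (auto simp: G_def)
      show "card e' = k"
        using ae cardE inj_on_subset[OF inj[OF fDV[OF ae(1)]] sub[OF ae(2)]] by (simp add: card_image)
    qed
    show "card (verts G) = card (verts F) * card D"
      using g by (simp add: G_def card_image card_cartesian_product V_def)
    show "P \<subseteq> copies F G"
      using iso fDV sub by (fastforce simp: P_def copies_def subgraph_def emb_def G_def)
    show "edge_disjoint P" using disj by (auto simp: edge_disjoint_def P_def pairwise_def)
    show "card P = card W" using injW by (simp add: P_def card_image)
    show "card (copies F G) \<le> card D ^ (card (verts F) - 1)" using few by (simp add: V_def)
  qed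
qed

section \<open>Planting copies along linear forms\<close>

text \<open>The vector \<open>a\<close> is read as the coefficients of a polynomial: outside the
  cycle it is evaluated at a negative integer, and on the cycle only its affine part is evaluated,
  at the position \<open>idx v\<close>.\<close>

definition plant :: "nat \<Rightarrow> 'a set \<Rightarrow> ('a \<Rightarrow> nat) \<Rightarrow> ('a \<Rightarrow> nat) \<Rightarrow> (nat \<Rightarrow> nat) \<Rightarrow> 'a \<Rightarrow> int" where
  "plant k X idx \<tau> a v = (if v \<in> X then int (a 0) + int (idx v) * int (a 1)
     else (\<Sum>j<k. int (a j) * (- 1 - int (\<tau> v)) ^ j))"

text \<open>The difference of the two coefficient vectors is a polynomial of degree below
  \<open>k\<close>. The vertices of \<open>e\<close> impose \<open>k\<close> vanishing conditions on
  it, at most two of them on its affine part, so \<open>poly_zero_from_roots_and_affine_part\<close>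
  applies.\<close>

lemma plant_determines_coefficients:
  assumes k: "2 \<le> k" "card e = k" and X: "card (e \<inter> X) \<le> 2"
    and inj: "inj_on \<tau> e" "inj_on idx (e \<inter> X)"
    and eq: "\<And>v. v \<in> e \<Longrightarrow> plant k X idx \<tau> a v = plant k X idx \<tau> a' v" and j: "j < k"
  shows "a j = a' j"
proof -
  have fin: "finite e" using k by (intro card_ge_0_finite) simp
  define p where "p = (\<Sum>j<k. monom (real (a j) - real (a' j)) j)"
  have coeff: "coeff p i = (if i < k then real (a i) - real (a' i) else 0)" for i
    by (simp add: p_def coeff_sum)
  have poly: "poly p t = (\<Sum>j<k. (real (a j) - real (a' j)) * t ^ j)" for t
    by (simp add: p_def poly_sum poly_monom)
  define T where "T = (\<lambda>v. - 1 - real (\<tau> v)) ` (e - X)"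
  define Z where "Z = (\<lambda>v. real (idx v)) ` (e \<inter> X)"
  have cT: "card T = card (e - X)" unfolding T_def
    using inj(1) by (intro card_image) (auto simp: inj_on_def)
  have cZ: "card Z = card (e \<inter> X)" unfolding Z_def
    using inj(2) by (intro card_image) (auto simp: inj_on_def)
  have "p = 0"
  proof (rule poly_zero_from_roots_and_affine_part)
    show "degree p < k"
      using k coeff by (metis degree_0 leading_coeff_0_iff less_le_trans pos2)
    show "card T + card Z = k"
      using card_Diff_subset_Int[of e X] fin k card_mono[of e "e \<inter> X"] by (simp add: cT cZ)
  next
    fix t assume "t \<in> T"
    then obtain v where v: "v \<in> e" "v \<notin> X" "t = - 1 - real (\<tau> v)" by (auto simp: T_def)
    have "real_of_int (plant k X idx \<tau> a v) = real_of_int (plant k X idx \<tau> a' v)"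
      using eq[OF v(1)] by simp
    then show "poly p t = 0" using v
      by (simp add: plant_def poly left_diff_distrib sum_subtractf)
  next
    fix z assume "z \<in> Z"
    then obtain v where v: "v \<in> e" "v \<in> X" "z = real (idx v)" by (auto simp: Z_def)
    have "real_of_int (plant k X idx \<tau> a v) = real_of_int (plant k X idx \<tau> a' v)"
      using eq[OF v(1)] by simp
    then show "coeff p 0 + z * coeff p 1 = 0" using v k
      by (simp add: plant_def coeff algebra_simps)
  qed (use fin X cZ in \<open>auto simp: T_def Z_def\<close>)
  then show ?thesis using coeff[of j] j by simp
qed

text \<open>The bound is linear in \<open>m\<close>, with a factor depending only on
  \<open>k\<close> and \<open>h\<close>; this keeps the parts of the host of size linear in
  \<open>m\<close>.\<close>

lemma plant_bounded:
  assumes a: "\<And>j. j < k \<Longrightarrow> a j < m" and k: "2 \<le> k" and "\<tau> v < h" "v \<in> X \<Longrightarrow> idx v < h"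
  shows "\<bar>plant k X idx \<tau> a v\<bar> \<le> int (m * (k * h ^ k + h + 1))"
proof (cases "v \<in> X")
  case True
  have "a 0 + idx v * a 1 \<le> m + h * m"
    using a[of 0] a[of 1] k assms(4)[OF True] by (intro add_mono mult_mono) auto
  also have "\<dots> \<le> m * (k * h ^ k + h + 1)" by (simp add: algebra_simps)
  finally show ?thesis using True by (simp add: plant_def flip: of_nat_mult of_nat_add)
next
  case False
  have "\<bar>int (a j) * (- 1 - int (\<tau> v)) ^ j\<bar> \<le> int (m * h ^ k)" if "j < k" for j
  proof -
    have "(1 + \<tau> v) ^ j \<le> h ^ j" using assms(3) by (intro power_mono) auto
    also have "\<dots> \<le> h ^ k" using assms(3) that by (intro power_increasing) auto
    finally have "a j * (1 + \<tau> v) ^ j \<le> m * h ^ k" using a[OF that] by (intro mult_mono) auto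
    moreover have "\<bar>int (a j) * (- 1 - int (\<tau> v)) ^ j\<bar> = int (a j * (1 + \<tau> v) ^ j)"
      by (simp add: abs_mult power_abs add.commute)
    ultimately show ?thesis by (metis of_nat_mono)
  qed
  then have "(\<Sum>j<k. \<bar>int (a j) * (- 1 - int (\<tau> v)) ^ j\<bar>) \<le> (\<Sum>j<k. int (m * h ^ k))"
    by (intro sum_mono) simp
  also have "\<dots> \<le> int (m * (k * h ^ k + h + 1))" by (simp add: algebra_simps)
  finally have "\<bar>\<Sum>j<k. int (a j) * (- 1 - int (\<tau> v)) ^ j\<bar> \<le> int (m * (k * h ^ k + h + 1))"
    by (rule order.trans[OF sum_abs])
  then show ?thesis using False by (simp only: plant_def if_False)
qed

text \<open>For fixed \<open>r\<close>, the edge-disjoint copies have density of order \<open>1 / d\<^sup>2\<close>, but all copies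
  together have density at most \<open>1 / L \<le> 1 / d ^ r\<close>.\<close>

lemma host_with_few_copies:
  fixes F :: "'a hypergraph"
  assumes k: "2 \<le> k" and F: "k_graph k F" and core: "is_core F"
    and cyc: "has_induced_cycle (shadow2 F) l" "4 \<le> l" and d: "1 \<le> d" and r: "1 \<le> r"
  defines "m \<equiv> ((l - 1) * d) ^ r"
  defines "L \<equiv> 2 * (m * (k * card (verts F) ^ k + card (verts F) + 1)) + 1"
  obtains G :: "nat hypergraph" and P where "k_graph k G" "card (verts G) = card (verts F) * L"
    "P \<subseteq> copies F G" "edge_disjoint P" "m ^ (k - 1) * d ^ r \<le> r * d\<^sup>2 * card P"
    "card (copies F G) \<le> L ^ (card (verts F) - 1)" "1 \<le> card (verts F)"
proof -
  define V where "V = verts F"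
  define h where "h = card V"
  define q where "q = l - 1"
  have finV: "finite V" and sub: "\<And>e. e \<in> edges F \<Longrightarrow> e \<subseteq> V"
    and cardE: "\<And>e. e \<in> edges F \<Longrightarrow> card e = k"
    using F by (auto simp: k_graph_def V_def)
  obtain x where injx: "inj_on x {..<l}" and xV: "x ` {..<l} \<subseteq> V"
    and adj: "\<And>i. i < l \<Longrightarrow> \<exists>e\<in>edges F. x i \<in> e \<and> x (Suc i mod l) \<in> e"
    and two: "\<And>e. e \<in> edges F \<Longrightarrow> card (e \<inter> x ` {..<l}) \<le> 2"
    using cycle_of_shadow[OF cyc] unfolding V_def by metis
  define X where "X = x ` {..<l}"
  define idx where "idx = inv_into {..<l} x"
  have idx: "idx (x i) = i" "x i \<in> X" if "i < l" for i
    using that injx by (auto simp: idx_def X_def)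
  have lh: "l \<le> h" using card_mono[OF finV xV] injx by (simp add: card_image h_def)
  obtain \<tau> where "bij_betw \<tau> V {0..<h}" using ex_bij_betw_finite_nat[OF finV] h_def by blast
  then have \<tau>: "inj_on \<tau> V" "\<And>v. v \<in> V \<Longrightarrow> \<tau> v < h" by (auto simp: bij_betw_def)
  have q1: "1 \<le> q" and m: "m = (q * d) ^ r" using cyc by (auto simp: q_def m_def)
  obtain S where S: "S \<subseteq> {..<m}" "d ^ r \<le> r * d\<^sup>2 * card S"
    and mean: "\<forall>s. \<forall>t\<in>S. (\<forall>i<q. s i \<in> S) \<and> (\<Sum>i<q. s i) = q * t \<longrightarrow> (\<forall>i<q. s i = t)"
    using exists_large_set_without_nontrivial_mean[OF q1 d r, folded m] by blast
  \<comment> \<open>Only the common difference \<open>a 1\<close> is confined to \<open>S\<close>;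
    the other \<open>k - 1\<close> coordinates range freely below \<open>m\<close>.\<close>
  define W where "W = (\<Pi>\<^sub>E j\<in>{..<k}. if j = 1 then S else {..<m})"
  have W1: "a 1 \<in> S" if "a \<in> W" for a
    using PiE_mem[OF that[unfolded W_def], of 1] k by simp
  have W: "a j < m" if "a \<in> W" "j < k" for a j
    using PiE_mem[of a "{..<k}" "\<lambda>j. if j = 1 then S else {..<m}" j] that S(1)
    by (auto simp: W_def split: if_splits)
  have "finite S" using S(1) finite_subset by blast
  have "card W = (\<Prod>j<k. card (if j = 1 then S else {..<m}))" by (simp add: W_def card_PiE)
  also have "\<dots> = card S * (\<Prod>j\<in>{..<k} - {1}. card (if j = 1 then S else {..<m}))"
    using k by (subst prod.remove[of _ 1]) auto
  also have "(\<Prod>j\<in>{..<k} - {1}. card (if j = 1 then S else {..<m})) = (\<Prod>j\<in>{..<k} - {1}. m)"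
    by (intro prod.cong) auto
  finally have cW: "card W = card S * m ^ (k - 1)" using k by simp
  define B where "B = m * (k * h ^ k + h + 1)"
  define f where "f = plant k X idx \<tau>"
  have progression: "b (x 2) = 2 * b (x 1) - b (x 0)"
    if b: "\<And>e. e \<in> edges F \<Longrightarrow> \<exists>a\<in>W. \<forall>v\<in>e. b v = f a v" for b
  proof -
    \<comment> \<open>The factor is \<open>1\<close> on a forward step and \<open>- q\<close> on the
      closing edge from \<open>x q\<close> back to \<open>x 0\<close>, so one formula covers the
      whole cycle.\<close>
    have step: "\<exists>s\<in>S. b (x (Suc i mod l)) - b (x i) = (int (Suc i mod l) - int i) * int s"
      if "i < l" for i
    proof -
      obtain e where e: "e \<in> edges F" "x i \<in> e" "x (Suc i mod l) \<in> e" using adj[OF \<open>i < l\<close>] by blast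
      obtain a where a: "a \<in> W" "\<forall>v\<in>e. b v = f a v" using b[OF e(1)] by blast
      have "b (x i) = f a (x i)" "b (x (Suc i mod l)) = f a (x (Suc i mod l))" using a e by auto
      moreover have "Suc i mod l < l" using that by simp
      ultimately show ?thesis using a(1) W1[OF a(1)] k that
        by (intro bexI[of _ "a 1"]) (auto simp: f_def plant_def idx algebra_simps)
    qed
    have "\<exists>s\<in>S. b (x (Suc i)) - b (x i) = int s" if "i < q" for i
      using step[of i] that by (simp add: q_def)
    then obtain s where s: "\<And>i. i < q \<Longrightarrow> s i \<in> S \<and> b (x (Suc i)) - b (x i) = int (s i)" by metis
    have "Suc q = l" using cyc by (simp add: q_def)
    then obtain t where t: "t \<in> S" "b (x 0) - b (x q) = - (int q * int t)"
      using step[of q] by auto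
    \<comment> \<open>The forward steps telescope to the negative of the closing step, which is
      exactly the mean equation excluded in \<open>S\<close> except for equal terms.\<close>
    have "int (\<Sum>i<q. s i) = (\<Sum>i<q. b (x (Suc i)) - b (x i))" using s by simp
    also have "\<dots> = b (x q) - b (x 0)" by (rule sum_lessThan_telescope)
    also have "\<dots> = int (q * t)" using t by simp
    finally have "(\<Sum>i<q. s i) = q * t" by linarith
    then have eq: "s i = t" if "i < q" for i using mean s t that by blast
    have "3 \<le> q" using cyc by (simp add: q_def)
    then show ?thesis using s[of 0] s[of 1] eq[of 0] eq[of 1] by (simp add: numeral_2_eq_2)
  qed
  have "card {- int B..int B} = 2 * B + 1" by simp
  then have cD: "card {- int B..int B} = L" by (simp only: B_def L_def h_def V_def)
  \<comment> \<open>The dependent vertex is \<open>x 2\<close>: \<open>progression\<close> computes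
    its value from those at \<open>x 0\<close> and \<open>x 1\<close>.\<close>
  show thesis
  proof (rule planted_host[of k F "{- int B..int B}" W f "x 2"])
    show "k_graph k F" "is_core F" "finite {- int B..int B}" using F core by auto
    show "edges F \<noteq> {}" using adj[of 0] cyc by auto
    show "f a v \<in> {- int B..int B}" if "a \<in> W" "v \<in> verts F" for a v
    proof -
      have "idx v < h" if "v \<in> X" using that idx lh by (fastforce simp: X_def)
      then have "\<bar>f a v\<bar> \<le> int B"
        unfolding f_def B_def using W[OF \<open>a \<in> W\<close>] \<tau>(2) that k
        by (intro plant_bounded) (auto simp: V_def)
      then show ?thesis by auto
    qed
    show "a = a'" if a: "a \<in> W" "a' \<in> W" and e: "e \<in> edges F"
      and eq: "\<And>v. v \<in> e \<Longrightarrow> f a v = f a' v" for a a' e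
    proof -
      have "inj_on idx X" using injx by (auto simp: idx_def X_def intro: inj_on_inv_into)
      then have inj: "inj_on idx (e \<inter> X)" "inj_on \<tau> e"
        using \<tau>(1) sub[OF e] by (blast intro: inj_on_subset)+
      have "a j = a' j" if "j < k" for j
        using plant_determines_coefficients[OF k cardE[OF e] two[OF e, folded X_def] inj(2,1) _ that] eq
        by (simp add: f_def)
      then show ?thesis using a by (auto simp: W_def intro: PiE_ext)
    qed
    show "x 2 \<in> verts F" using xV cyc by (auto simp: V_def)
    fix b b' :: "'a \<Rightarrow> int"
    assume b: "\<And>e. e \<in> edges F \<Longrightarrow> \<exists>a\<in>W. \<forall>v\<in>e. b v = f a v"
      "\<And>e. e \<in> edges F \<Longrightarrow> \<exists>a\<in>W. \<forall>v\<in>e. b' v = f a v"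
      and agree: "\<And>v. v \<in> verts F - {x 2} \<Longrightarrow> b v = b' v"
    have "x i \<in> verts F - {x 2}" if "i < 2" for i
      using that xV cyc inj_onD[OF injx, of i 2] by (auto simp: V_def)
    then have "b (x 0) = b' (x 0)" "b (x 1) = b' (x 1)" using agree by auto
    then show "b (x 2) = b' (x 2)" using progression[OF b(1)] progression[OF b(2)] by simp
  next
    fix G :: "nat hypergraph" and P
    assume G: "k_graph k G" "card (verts G) = card (verts F) * card {- int B..int B}"
      "P \<subseteq> copies F G" "edge_disjoint P" "card P = card W"
      "card (copies F G) \<le> card {- int B..int B} ^ (card (verts F) - 1)"
    show thesis
    proof (rule that)
      show "card (verts G) = card (verts F) * L" using G(2) cD by simp
      show "m ^ (k - 1) * d ^ r \<le> r * d\<^sup>2 * card P"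
        using mult_le_mono2[OF S(2), of "m ^ (k - 1)"] by (simp add: G(5) cW mult_ac)
      show "card (copies F G) \<le> L ^ (card (verts F) - 1)" using G(6) cD by simp
      show "1 \<le> card (verts F)" using lh cyc by (simp add: h_def V_def)
    qed fact+
  qed
qed

section \<open>Choice of parameters and contradiction\<close>

theorem lemma1p1:
  fixes k :: nat and F :: "'a hypergraph"
  assumes "2 \<le> k"
    and "k_graph k F"
    and "is_core F"
    and "\<exists>l\<ge>4. has_induced_cycle (shadow2 F) l"
  shows "\<not> polynomial_removal_lemma k F"
proof
  assume "polynomial_removal_lemma k F"
  then obtain c C :: real where c: "c > 0" and C: "C > 0" and
    "\<forall>\<epsilon>::real. \<forall>n::nat. \<forall>G :: nat hypergraph.
       0 < \<epsilon> \<and> \<epsilon> < 1 \<and> 1 \<le> n \<and> k_graph k G \<and> card (verts G) = n \<and>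
       (\<exists>P \<subseteq> copies F G. edge_disjoint P \<and> \<epsilon> * real n ^ k \<le> real (card P))
       \<longrightarrow> c * \<epsilon> powr C * real n ^ card (verts F) \<le> real (card (copies F G))"
    unfolding polynomial_removal_lemma_def by (elim exE conjE) (rule that)
  note removal = this(3)[rule_format]
  obtain l where l: "4 \<le> l" "has_induced_cycle (shadow2 F) l" using assms(4) by blast
  define h where "h = card (verts F)"
  define q where "q = l - 1"
  define M where "M = k * h ^ k + h + 1"
  \<comment> \<open>The part size is at least \<open>d ^ r\<close>, so this \<open>r\<close> lets it
    outgrow the factor of order \<open>d powr (2 * C)\<close> lost in
    \<open>\<epsilon> powr C\<close> when \<open>\<epsilon> = K / d\<^sup>2\<close>.\<close>
  define r where "r = nat \<lceil>2 * C + 1\<rceil>"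
  have r: "2 * C + 1 \<le> real r" using C by (simp add: r_def)
  then have r1: "1 \<le> r" using C by linarith
  have q: "3 \<le> q" and M: "1 \<le> M" using l by (auto simp: q_def M_def)
  \<comment> \<open>\<open>K\<close> makes \<open>K / d\<^sup>2\<close> a valid density of planted
    copies: \<open>r\<close> comes from the pigeonhole bound, \<open>q ^ r\<close> from
    \<open>m = (q * d) ^ r\<close>, and the last factor from
    \<open>h * L \<le> 3 * h * M * m\<close>.\<close>
  define K where "K = 1 / (real r * real q ^ r * (3 * real h * real M) ^ k)"
  \<comment> \<open>An instance with \<open>d = 1\<close> serves to read off that \<open>F\<close>
    has a vertex.\<close>
  have h: "1 \<le> h"
    by (rule host_with_few_copies[OF assms(1-3) l(2,1) order.refl r1]) (simp add: h_def)
  have "1 * 1 < real q ^ r * (3 * real h * real M) ^ k"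
  proof (rule mult_strict_mono')
    have "3 * 1 * 1 \<le> 3 * real h * real M" using h M by (intro mult_mono) auto
    then show "1 < (3 * real h * real M) ^ k" using assms(1) by (intro one_less_power) auto
  qed (use q r1 in \<open>auto intro: one_less_power\<close>)
  then have "1 * 1 < real r * (real q ^ r * (3 * real h * real M) ^ k)"
    using r1 by (intro mult_le_less_imp_less) auto
  then have K: "0 < K" "K < 1" by (auto simp: K_def mult.assoc divide_less_eq_1)
  \<comment> \<open>The left side is unbounded in \<open>d\<close>, so this estimate for every
    \<open>d\<close> is contradictory.\<close>
  have bound: "c * K powr C * real d \<le> 1" if d: "1 \<le> d" for d :: nat
  proof -
    define m where "m = (q * d) ^ r"
    define L where "L = 2 * (m * M) + 1"
    have L0: "0 < L" by (simp add: L_def)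
    define \<epsilon> where "\<epsilon> = K / (real d)\<^sup>2"
    obtain G :: "nat hypergraph" and P where G: "k_graph k G" "card (verts G) = h * L"
      and P: "P \<subseteq> copies F G" "edge_disjoint P" "m ^ (k - 1) * d ^ r \<le> r * d\<^sup>2 * card P"
      and few: "card (copies F G) \<le> L ^ (h - 1)"
      using host_with_few_copies[OF assms(1-3) l(2,1) d r1,
          folded q_def, folded h_def m_def, folded M_def, folded L_def] by blast
    have m: "1 \<le> m" using q d by (simp add: m_def)
    have \<epsilon>: "0 < \<epsilon>" "\<epsilon> < 1"
    proof -
      show "0 < \<epsilon>" using K d by (simp add: \<epsilon>_def)
      have "1 \<le> (real d)\<^sup>2" using d by (intro one_le_power) simp
      then have "K < (real d)\<^sup>2" using K by linarith
      then show "\<epsilon> < 1" using d by (simp add: \<epsilon>_def)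
    qed
    have "L \<le> 3 * (m * M)" using m M by (simp add: L_def)
    then have "real h * real L \<le> real h * real (3 * (m * M))"
      by (intro mult_left_mono) (auto simp only: of_nat_mono of_nat_0_le_iff)
    then have "real (h * L) ^ k \<le> ((3 * real h * real M) * real m) ^ k"
      by (intro power_mono) (auto simp: mult_ac)
    also have "\<dots> = (3 * real h * real M) ^ k * (real m * real m ^ (k - 1))"
      using assms(1) by (simp add: power_mult_distrib flip: power_Suc)
    \<comment> \<open>One of the \<open>k\<close> factors \<open>m\<close> is split as
      \<open>q ^ r * d ^ r\<close> to match the lower bound on \<open>card P\<close>.\<close>
    also have "\<dots> = (3 * real h * real M) ^ k * real q ^ r * (real m ^ (k - 1) * real d ^ r)"
      by (simp add: m_def power_mult_distrib)
    also have "\<dots> \<le> (3 * real h * real M) ^ k * real q ^ r * (real r * (real d)\<^sup>2 * real (card P))"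
      using of_nat_mono[OF P(3), where ?'a = real] by (intro mult_left_mono) auto
    finally have "\<epsilon> * real (h * L) ^ k \<le> \<epsilon> * \<dots>" using \<epsilon> by (intro mult_left_mono) auto
    also have "\<dots> = real (card P)"
      using r1 q h M d by (simp add: \<epsilon>_def K_def field_simps)
    finally have "\<epsilon> * real (h * L) ^ k \<le> real (card P)" .
    then have "c * \<epsilon> powr C * real (h * L) ^ h \<le> real (card (copies F G))"
      unfolding h_def
      using \<epsilon> G P h by (intro removal conjI exI[of _ P]) (auto simp: h_def L_def)
    also have "\<dots> \<le> real L ^ (h - 1)" using few by (metis of_nat_mono of_nat_power)
    finally have "c * \<epsilon> powr C * real (h * L) ^ h \<le> real L ^ (h - 1)" .
    \<comment> \<open>Dropping \<open>h ^ h\<close> leaves one power of \<open>L\<close> more than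
      in the upper bound on the number of copies.\<close>
    moreover have "real L * real L ^ (h - 1) \<le> real (h * L) ^ h"
    proof -
      have "L ^ h \<le> (h * L) ^ h" using h by (intro power_mono) auto
      moreover have "real L * real L ^ (h - 1) = real (L ^ h)" using h by (simp flip: power_Suc)
      ultimately show ?thesis by (metis of_nat_mono of_nat_power)
    qed
    ultimately have "c * \<epsilon> powr C * (real L * real L ^ (h - 1)) \<le> real L ^ (h - 1)"
      using c by (meson mult_left_mono mult_nonneg_nonneg order.trans powr_ge_zero less_imp_le)
    then have "c * \<epsilon> powr C * real L * real L ^ (h - 1) \<le> 1 * real L ^ (h - 1)"
      by (simp add: mult.assoc)
    then have le1: "c * \<epsilon> powr C * real L \<le> 1"
      by (rule mult_right_le_imp_le) (use L0 in simp)
    have "real d powr (2 * C + 1) \<le> real d powr real r" using d r by (intro powr_mono) auto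
    also have "\<dots> = real (d ^ r)" using d by (simp add: powr_realpow)
    also have "d ^ r \<le> m" using q by (auto simp: m_def intro: power_mono)
    also have "m \<le> L" using mult_le_mono2[OF M, of m] unfolding L_def by linarith
    finally have "real d powr (2 * C + 1) \<le> real L" by simp
    then have "c * \<epsilon> powr C * real d powr (2 * C + 1) \<le> 1"
      using le1 c by (meson mult_left_mono mult_nonneg_nonneg order.trans powr_ge_zero less_imp_le)
    moreover have "\<epsilon> powr C * real d powr (2 * C + 1) = K powr C * real d"
    proof -
      have "(real d)\<^sup>2 powr C = real d powr (2 * C)"
        using d by (simp add: powr_powr flip: powr_numeral)
      then show ?thesis using K d by (simp add: \<epsilon>_def powr_divide powr_add)
    qed
    ultimately show ?thesis by (simp add: mult.assoc)
  qed
  have pos: "0 < c * K powr C" using c K by simp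
  obtain d :: nat where "1 / (c * K powr C) < real d" using reals_Archimedean2 by blast
  then have "1 < c * K powr C * real d" using pos by (simp add: field_simps)
  moreover from this have "1 \<le> d" by (cases d) auto
  ultimately show False using bound[of d] by simp
qed

end
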